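(* There exists an absolute constant $C>0$ such that the following holds. Let $1\le m\le n$ be integers, let $\mu$ be a measure on $\mathbb{R}^n$ given by $d\mu(x)=\phi(x)\,dx$, where $\phi\colon\mathbb{R}^n\to[0,\infty)$ is radially decreasing, and let $H\subset\mathbb{R}^n$ be an $m$-dimensional linear subspace. Then for any convex body $K\subset\mathbb{R}^n$ and any $s\in(0,\infty)$, $$\mu((K-K)\cap H)\le\binom{n+m+s}{m+s}\sup_{y\in\mathbb{R}^n}\mu((K-y)\cap H)\le\left[C\cdot\frac{n+s}{m+s}\right]^{m+s}\sup_{y\in\mathbb{R}^n}\mu((K-y)\cap H).$$
   Context: A convex body is a compact convex subset of $\mathbb{R}^n$ with non-empty interior; $K-K=\{a-b:a,b\in K\}$. A function $\phi$ is radially decreasing if $\phi(tx)\ge\phi(x)$ for all $t\in[0,1]$, $x\in\mathbb{R}^n$. If $\mu$ has (Borel) density $\phi$ and $H$ is a linear subspace, then $\mu(A\cap H)=\int_H\phi(x)\chi_A(x)\,dx$ with $dx$ Lebesgue measure on $H$. For real arguments, $\binom{a}{b}=\frac{\Gamma(a+1)}{\Gamma(b+1)\Gamma(a-b+1)}$. *)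

theory Defs
  imports "HOL-Analysis.Analysis" "HOL-Library.Function_Algebras"
begin

(* The dimension n is quantified inside the statement (the constant must not depend on it), so
   R^n cannot be a type. As in HOL-Analysis.Abstract_Euclidean_Space it is the set
   topspace (Euclidean_space n) = {x. \<forall>i\<ge>n. x i = 0} of sequences, with the subspace topology.
   Pointwise scalar multiplication makes the library notions convex, subspace, span and dim
   available for sets of sequences. *)

instantiation "fun" :: (type, real_vector) real_vector
begin

definition scaleR_fun :: "real \<Rightarrow> ('a \<Rightarrow> 'b) \<Rightarrow> 'a \<Rightarrow> 'b"
  where "scaleR_fun c f = (\<lambda>x. c *\<^sub>R f x)"

instance
  by standard (simp_all add: scaleR_fun_def fun_eq_iff algebra_simps)

end

lemma scaleR_fun_apply [simp]: "(c *\<^sub>R f) x = c *\<^sub>R f x"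
  by (simp add: scaleR_fun_def)

definition euclidean_inner :: "nat \<Rightarrow> (nat \<Rightarrow> real) \<Rightarrow> (nat \<Rightarrow> real) \<Rightarrow> real"
  where "euclidean_inner n x y = (\<Sum>i<n. x i * y i)"

definition orthonormal_basis :: "nat \<Rightarrow> (nat \<Rightarrow> real) set \<Rightarrow> (nat \<Rightarrow> nat \<Rightarrow> real) \<Rightarrow> bool"
  where "orthonormal_basis n H u \<longleftrightarrow>
    (\<forall>i<dim H. \<forall>j<dim H. euclidean_inner n (u i) (u j) = (if i = j then 1 else 0)) \<and>
    span (u ` {..<dim H}) = H"

(* Lebesgue measure on a linear subspace H of R^n: the image of Lebesgue measure on R^(dim H)
   under the linear isometry given by an orthonormal basis of H. Such a basis exists (lemma
   ex_orthonormal_basis below), and by rotation invariance of Lebesgue measure the choice of the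
   basis does not matter. *)

definition subspace_lborel :: "nat \<Rightarrow> (nat \<Rightarrow> real) set \<Rightarrow> (nat \<Rightarrow> real) measure"
  where "subspace_lborel n H =
    (let u = (SOME u. orthonormal_basis n H u)
     in distr (Pi\<^sub>M {..<dim H} (\<lambda>_. lborel)) borel (\<lambda>t. \<Sum>i<dim H. t i *\<^sub>R u i))"

(* The measure of A \<inter> H for the measure on R^n with density phi. *)

definition section_measure ::
    "nat \<Rightarrow> ((nat \<Rightarrow> real) \<Rightarrow> real) \<Rightarrow> (nat \<Rightarrow> real) set \<Rightarrow> (nat \<Rightarrow> real) set \<Rightarrow> ennreal"
  where "section_measure n \<phi> H A =
    (\<integral>\<^sup>+x. ennreal (\<phi> x) * indicator (A \<inter> H) x \<partial>subspace_lborel n H)"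

definition convex_body :: "nat \<Rightarrow> (nat \<Rightarrow> real) set \<Rightarrow> bool"
  where "convex_body n K \<longleftrightarrow>
    compactin (Euclidean_space n) K \<and> convex K \<and> Euclidean_space n interior_of K \<noteq> {}"

definition radially_decreasing :: "nat \<Rightarrow> ((nat \<Rightarrow> real) \<Rightarrow> real) \<Rightarrow> bool"
  where "radially_decreasing n \<phi> \<longleftrightarrow>
    (\<forall>x\<in>topspace (Euclidean_space n). \<forall>t\<in>{0..1}. \<phi> (t *\<^sub>R x) \<ge> \<phi> x)"

definition real_binomial :: "real \<Rightarrow> real \<Rightarrow> real"
  where "real_binomial a b = Gamma (a + 1) / (Gamma (b + 1) * Gamma (a - b + 1))"

lemma sum_fun_apply: "(\<Sum>i\<in>A. f i) x = (\<Sum>i\<in>A. f i x)"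
  by (induction A rule: infinite_finite_induct) auto

lemma measurable_orthonormal_coordinates:
  "(\<lambda>t. \<Sum>i<m. t i *\<^sub>R u i) \<in> Pi\<^sub>M {..<m} (\<lambda>_. lborel) \<rightarrow>\<^sub>M (borel :: (nat \<Rightarrow> real) measure)"
proof -
  have "(\<lambda>t. \<Sum>i<m. t i *\<^sub>R u i) = (\<lambda>t k. \<Sum>i<m. t i * u i k)"
    by (simp add: fun_eq_iff sum_fun_apply)
  moreover have "(\<lambda>t k. \<Sum>i<m. t i * u i k) \<in> borel_measurable (Pi\<^sub>M {..<m} (\<lambda>_. lborel))"
    by (rule measurable_coordinatewise_then_product) measurable
  ultimately show ?thesis by simp
qed

lemma ex_orthonormal_basis:
  assumes sub: "subspace H" and H: "H \<subseteq> topspace (Euclidean_space n)"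
  shows "\<exists>u. orthonormal_basis n H u"
proof -
  define on where "on = (\<lambda>(k::nat) (u :: nat \<Rightarrow> nat \<Rightarrow> real). (\<forall>i<k. u i \<in> H) \<and>
    (\<forall>i<k. \<forall>j<k. euclidean_inner n (u i) (u j) = (if i = j then 1 else (0::real))))"
  have inner_sum: "euclidean_inner n (\<Sum>i\<in>A. c i *\<^sub>R u i) v = (\<Sum>i\<in>A. c i * euclidean_inner n (u i) v)"
    for A :: "nat set" and c u v
    by (simp add: euclidean_inner_def sum_fun_apply sum_distrib_left sum_distrib_right mult.assoc)
       (rule sum.swap)
  have onb: "independent (u ` {..<k}) \<and> card (u ` {..<k}) = k" if "on k u" for k u
  proof -
    have inj: "inj_on u {..<k}"
      using that unfolding on_def inj_on_def by (metis lessThan_iff zero_neq_one)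
    have "independent (u ` {..<k})"
      unfolding real_vector.dependent_finite[OF finite_imageI[OF finite_lessThan]]
    proof (rule notI, elim exE conjE bexE)
      fix c v assume v: "v \<in> u ` {..<k}" "c v \<noteq> 0" and s: "(\<Sum>v\<in>u ` {..<k}. c v *\<^sub>R v) = 0"
      obtain j where j: "j < k" "v = u j" using v by auto
      have "0 = euclidean_inner n (\<Sum>i<k. c (u i) *\<^sub>R u i) (u j)"
        using s by (simp add: sum.reindex[OF inj] o_def euclidean_inner_def)
      also have "\<dots> = (\<Sum>i<k. c (u i) * (if i = j then 1 else 0))"
        unfolding inner_sum using that j by (intro sum.cong) (auto simp: on_def)
      also have "\<dots> = c (u j)" using j by (simp add: if_distrib[of "\<lambda>x. _ * x"] cong: if_cong)
      finally show False using v j by simp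
    qed
    then show ?thesis using inj by (simp add: card_image)
  qed
  have ext: "\<exists>w. on (Suc k) (u(k := w))" if u: "on k u" and v: "v \<in> H" "v \<notin> span (u ` {..<k})" for k u v
  proof -
    define p where "p = (\<Sum>i<k. euclidean_inner n (u i) v *\<^sub>R u i)"
    define w where "w = v - p"
    have p: "p \<in> span (u ` {..<k})"
      unfolding p_def by (intro span_sum span_scale span_base) auto
    have pH: "p \<in> H"
      using p span_minimal[OF _ sub, of "u ` {..<k}"] u unfolding on_def by auto
    have wH: "w \<in> H" unfolding w_def by (rule subspace_diff[OF sub v(1) pH])
    have w0: "w \<noteq> 0" using p v unfolding w_def by auto
    have wc: "\<forall>i\<ge>n. w i = 0" using wH H by (auto simp: topspace_Euclidean_space)
    define q where "q = euclidean_inner n w w"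
    have "q > 0"
    proof -
      obtain i where i: "w i \<noteq> 0" using w0 by (auto simp: fun_eq_iff)
      then have "i < n" using wc by (meson not_less)
      then show ?thesis unfolding q_def euclidean_inner_def
        using i by (intro sum_pos2[of _ i]) (auto simp: zero_less_mult_iff linorder_neq_iff)
    qed
    have sym: "euclidean_inner n x y = euclidean_inner n y x" for x y
      by (simp add: euclidean_inner_def mult.commute)
    have orth: "euclidean_inner n w (u j) = 0" if j: "j < k" for j
    proof -
      have "euclidean_inner n p (u j) = (\<Sum>i<k. euclidean_inner n (u i) v * (if i = j then 1 else 0))"
        unfolding p_def inner_sum using u j by (intro sum.cong) (auto simp: on_def)
      also have "\<dots> = euclidean_inner n v (u j)" using j by (simp add: sym if_distrib[of "\<lambda>x. _ * x"] cong: if_cong)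
      finally show ?thesis
        by (simp add: w_def euclidean_inner_def left_diff_distrib sum_subtractf)
    qed
    define w' where "w' = (1 / sqrt q) *\<^sub>R w"
    have 1: "euclidean_inner n w' w' = 1"
    proof -
      have "euclidean_inner n w' w' = (1 / sqrt q) * (1 / sqrt q) * q"
        unfolding q_def w'_def by (simp add: euclidean_inner_def sum_divide_distrib)
      also have "\<dots> = 1" using \<open>q > 0\<close> by (simp add: field_simps)
      finally show ?thesis .
    qed
    have 2: "euclidean_inner n w' (u j) = 0" if "j < k" for j
    proof -
      have "euclidean_inner n w' (u j) = (1 / sqrt q) * euclidean_inner n w (u j)"
        unfolding w'_def by (simp add: euclidean_inner_def sum_divide_distrib)
      then show ?thesis using orth[OF that] by simp
    qed
    have 3: "w' \<in> H" unfolding w'_def by (rule subspace_scale[OF sub wH])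
    have "on (Suc k) (u(k := w'))"
      using u 1 2 2[unfolded sym[of w']] 3 unfolding on_def by (auto simp: less_Suc_eq)
    then show ?thesis by blast
  qed
  have ex: "\<exists>u. on k u" if "k \<le> dim H" for k
    using that
  proof (induction k)
    case 0
    show ?case by (simp add: on_def)
  next
    case (Suc k)
    then obtain u where u: "on k u" by auto
    have "\<not> H \<subseteq> span (u ` {..<k})"
    proof
      assume "H \<subseteq> span (u ` {..<k})"
      then have "dim H \<le> card (u ` {..<k})" by (rule real_vector.dim_le_card) simp
      also have "\<dots> = k" using onb[OF u] by simp
      finally show False using Suc.prems by simp
    qed
    then show ?case using ext[OF u] by blast
  qed
  then obtain u where u: "on (dim H) u" by blast
  have "H \<subseteq> span (u ` {..<dim H})"
  proof (rule ccontr)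
    assume "\<not> H \<subseteq> span (u ` {..<dim H})"
    then obtain w where w: "on (Suc (dim H)) (u(dim H := w))" using ext[OF u] by blast
    define e where "e = (\<lambda>i j::nat. if i = j then 1 else (0::real))"
    have std: "H \<subseteq> span (e ` {..<n})"
    proof
      fix x assume "x \<in> H"
      then have "\<forall>i\<ge>n. x i = 0" using H by (auto simp: topspace_Euclidean_space)
      then have "x = (\<Sum>i<n. x i *\<^sub>R e i)"
        by (auto simp: fun_eq_iff sum_fun_apply e_def if_distrib cong: if_cong)
      then show "x \<in> span (e ` {..<n})"
        by (metis (no_types, lifting) image_eqI span_base span_scale span_sum)
    qed
    obtain B where B: "B \<subseteq> H" "independent B" "H \<subseteq> span B" "card B = dim H"
      using real_vector.basis_exists[of H] by blast
    have "finite B"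
      using real_vector.independent_span_bound[of "e ` {..<n}" B] B std by auto
    moreover have "(u(dim H := w)) ` {..<Suc (dim H)} \<subseteq> span B"
      using w B(3) unfolding on_def by blast
    ultimately have "card ((u(dim H := w)) ` {..<Suc (dim H)}) \<le> dim H"
      using real_vector.independent_span_bound onb[OF w] B(4) by metis
    then show False using onb[OF w] by simp
  qed
  moreover have "span (u ` {..<dim H}) \<subseteq> H"
    using u by (intro span_minimal[OF _ sub]) (auto simp: on_def)
  ultimately show ?thesis
    using u unfolding orthonormal_basis_def on_def by blast
qed

end

theory Submission
  imports Defs
begin

text \<open>
  Let \<open>D = K - K\<close> and let \<open>f x\<close> be the volume of \<open>K \<inter> (K - x)\<close>. Convexity gives
  \<open>f (r z) \<ge> (1 - r)^n vol K\<close> for \<open>z \<in> D\<close> and \<open>0 \<le> r \<le> 1\<close>, hence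
  \<open>f x \<ge> vol K \<integral>\<^sub>0\<^sup>1 n (1 - r)^(n - 1) [x \<in> r D] dr\<close>. Integrate this against \<open>\<mu>\<close> over \<open>H\<close>:
  on the left, Tonelli bounds the integral by \<open>vol K \<cdot> sup\<^sub>y \<mu>((K - y) \<inter> H)\<close>; on the right, radial
  monotonicity gives \<open>\<mu>(r D \<inter> H) \<ge> r^m \<mu>(D \<inter> H)\<close> and a Beta integral remains, which is the
  inverse of the binomial coefficient for \<open>s = 0\<close>. Writing the binomial coefficient as
  \<open>\<Prod>k<n. 1 + (m + s) / (k + 1)\<close> shows that it only increases with \<open>s\<close>.
\<close>

section \<open>The binomial coefficient with real lower argument\<close>

text \<open>The quotient of Gamma values is \<open>pochhammer (p + 1) n / fact n\<close>, a product
  of n quotients. In this form every factor is positive and increases with p, which is all that the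
  next two lemmas need.\<close>

lemma real_binomial_eq_prod:
  assumes "0 \<le> p"
  shows "real_binomial (real n + p) p = (\<Prod>k<n. 1 + p / (real k + 1))"
proof -
  have "p + 1 \<notin> \<int>\<^sub>\<le>\<^sub>0" using assms by (auto elim!: nonpos_Ints_cases)
  then have "Gamma (real n + p + 1) / Gamma (p + 1) = pochhammer (p + 1) n"
    by (subst pochhammer_Gamma) (simp_all add: add_ac)
  moreover have "Gamma (real n + 1) = fact n" using Gamma_fact[of n, where 'a=real] by (simp add: add.commute)
  ultimately have "real_binomial (real n + p) p = pochhammer (p + 1) n / fact n"
    by (simp add: real_binomial_def flip: divide_divide_eq_left)
  also have "\<dots> = (\<Prod>k<n. (p + 1 + real k) / (real k + 1))"
    by (simp add: pochhammer_prod fact_prod_Suc prod_dividef atLeast0LessThan add.commute)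
  also have "\<dots> = (\<Prod>k<n. 1 + p / (real k + 1))"
    by (intro prod.cong) (auto simp: field_simps)
  finally show ?thesis .
qed

lemma real_binomial_pos: "0 \<le> p \<Longrightarrow> 0 < real_binomial (real n + p) p"
  by (subst real_binomial_eq_prod) (auto intro!: prod_pos add_pos_nonneg)

lemma real_binomial_mono:
  assumes "0 \<le> p" "p \<le> q"
  shows "real_binomial (real n + p) p \<le> real_binomial (real n + q) q"
  using assms by (simp add: real_binomial_eq_prod) (intro prod_mono, auto intro!: add_nonneg_nonneg divide_right_mono)

text \<open>In other words (1 + 1/x)^x increases with x. The derivative \<open>?d\<close> is
  nonnegative by ln y \<le> y - 1 at y = t / (t + 1). This drives the induction in
  \<open>prod_one_plus_le_powr\<close>.\<close>

lemma mult_ln_one_plus_inverse_mono: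
  fixes x y :: real
  assumes "0 < x" "x \<le> y"
  shows "x * ln (1 + 1 / x) \<le> y * ln (1 + 1 / y)"
proof (rule DERIV_nonneg_imp_nondecreasing[OF assms(2)])
  fix t assume "x \<le> t" "t \<le> y"
  then have t: "0 < t" using assms by simp
  let ?d = "ln (1 + 1 / t) - 1 / (t + 1)"
  have "((\<lambda>t. t * ln (1 + 1 / t)) has_real_derivative ?d) (at t)"
  proof -
    have "((\<lambda>t. t * ln (1 + 1 / t)) has_real_derivative
        1 * ln (1 + 1 / t) + (- 1 / t\<^sup>2) / (1 + 1 / t) * t) (at t)"
      using t by (intro DERIV_mult DERIV_ident DERIV_ln_divide[THEN DERIV_chain2, THEN DERIV_cong])
        (auto intro!: derivative_eq_intros add_pos_pos simp: power2_eq_square)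
    moreover have "1 * ln (1 + 1 / t) + (- 1 / t\<^sup>2) / (1 + 1 / t) * t = ?d"
      using t add_pos_pos[OF t mult_pos_pos[OF t t]] by (simp add: field_simps power2_eq_square)
    ultimately show ?thesis by metis
  qed
  moreover have "0 \<le> ?d"
    using ln_diff_le[of 1 "1 + 1/t"] t ln_le_minus_one[of "t / (t + 1)"]
    by (auto simp: ln_div field_simps)
  ultimately show "\<exists>d. ((\<lambda>t. t * ln (1 + 1 / t)) has_real_derivative d) (at t) \<and> 0 \<le> d"
    by blast
qed

lemma ln_mult_self_powr:
  fixes a x y :: real
  assumes "0 < a" "0 < x" "0 < y"
  shows "ln (a * x powr x * y powr y) = ln a + x * ln x + y * ln y"
  using assms by (simp add: ln_mult)

text \<open>An entropy bound for the binomial coefficient, by induction on n after taking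
  logarithms. Passing from n to n + 1 adds n ln(1 + 1/n) on the left and (n + p) ln(1 + 1/(n + p))
  on the right, apart from the common term ln(n + 1 + p).\<close>

lemma prod_one_plus_le_powr:
  fixes p :: real
  assumes p: "0 < p"
  shows "(\<Prod>k<n. 1 + p / (real k + 1)) * real n powr real n * p powr p
    \<le> (real n + p) powr (real n + p)"
proof (induction n)
  case 0
  then show ?case by simp
next
  case (Suc n)
  let ?P = "\<Prod>k<n. 1 + p / (real k + 1)"
  let ?n = "real n"
  have P0: "0 < ?P" using p by (auto intro!: prod_pos add_pos_pos)
  \<comment> \<open>At n = 0 the induction hypothesis is void because \<open>0 powr 0 = 0\<close>;
    there both sides equal p ln p.\<close>
  have ln_P: "ln ?P + ?n * ln ?n + p * ln p \<le> (?n + p) * ln (?n + p)" 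
  proof (cases "n = 0")
    case False
    then have "ln (?P * ?n powr ?n * p powr p) \<le> ln ((?n + p) powr (?n + p))"
      using Suc.IH p P0 by (subst ln_le_cancel_iff) auto
    then show ?thesis using False p P0 by (subst (asm) ln_mult_self_powr) (auto simp: ln_powr)
  qed simp
  \<comment> \<open>For n > 0 both sides collapse to t ln(1 + 1/t), taken at t = n and at t = n +
    p.\<close>
  have step: "(?n + 1) * ln (?n + 1) - ?n * ln ?n - ln (?n + 1)
      \<le> (?n + 1 + p) * ln (?n + 1 + p) - (?n + p) * ln (?n + p) - ln (?n + 1 + p)"
  proof (cases "n = 0")
    case True
    then show ?thesis using p by (simp add: algebra_simps)
  next
    case False
    have "1 + 1 / ?n = (?n + 1) / ?n" "1 + 1 / (?n + p) = (?n + 1 + p) / (?n + p)"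
      using False p by (auto simp: field_simps)
    then show ?thesis
      using mult_ln_one_plus_inverse_mono[of ?n "?n + p"] False p
      by (simp add: ln_div algebra_simps)
  qed
  have "1 + p / (?n + 1) = (?n + 1 + p) / (?n + 1)" using p by (auto simp: field_simps)
  then have lnq: "ln (1 + p / (?n + 1)) = ln (?n + 1 + p) - ln (?n + 1)"
    using p by (simp add: ln_div)
  have "ln (?P * (1 + p / (?n + 1)) * (?n + 1) powr (?n + 1) * p powr p) \<le> ln ((?n + 1 + p) powr (?n + 1 + p))"
    using ln_P step lnq P0 p
    by (simp add: ln_mult ln_powr add_pos_pos mult_pos_pos) 
  moreover have "0 < ?P * (1 + p / (?n + 1)) * (?n + 1) powr (?n + 1) * p powr p"
    using P0 p by (intro mult_pos_pos) (auto intro!: add_pos_nonneg)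
  ultimately show ?case
    using p by (subst (asm) ln_le_cancel_iff) (auto simp: add_ac)
qed

text \<open>Dividing the entropy bound by n^n p^p leaves ((n + p)/n)^n ((n + p)/p)^p. The first
  factor is at most e^p because ln(1 + p/n) \<le> p/n.\<close>

lemma real_binomial_le_powr:
  fixes p :: real
  assumes p: "0 < p" and n: "0 < n"
  shows "real_binomial (real n + p) p \<le> (exp 1 * ((real n + p) / p)) powr p"
proof -
  let ?P = "\<Prod>k<n. 1 + p / (real k + 1)"
  have P0: "0 < ?P" using p by (auto intro!: prod_pos add_pos_pos)
  have "ln (?P * real n powr real n * p powr p) \<le> ln ((real n + p) powr (real n + p))"
    using prod_one_plus_le_powr[OF p, of n] P0 p n by (subst ln_le_cancel_iff) auto
  then have A: "ln ?P + real n * ln (real n) + p * ln p \<le> (real n + p) * ln (real n + p)"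
    using P0 p n by (subst (asm) ln_mult_self_powr) (auto simp: ln_powr)
  have "ln ((real n + p) / real n) \<le> (real n + p) / real n - 1"
    using p n by (intro ln_le_minus_one) auto
  then have "real n * (ln (real n + p) - ln (real n)) \<le> real n * (p / real n)"
    using p n by (intro mult_left_mono) (auto simp: ln_div field_simps)
  then have "ln ?P \<le> p * (1 + ln (real n + p) - ln p)"
    using A n by (simp add: algebra_simps)
  also have "\<dots> = ln ((exp 1 * ((real n + p) / p)) powr p)"
    using p n by (simp add: ln_powr ln_mult ln_div)
  finally show ?thesis
    using P0 p n by (subst (asm) ln_le_cancel_iff) (auto simp: real_binomial_eq_prod)
qed

section \<open>Integrals against the density n (1 - r)^(n - 1)\<close>

lemma real_binomial_eq_inverse_Beta:
  assumes "0 < n"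
  shows "real_binomial (real n + real m) (real m) * (real n * Beta (real m + 1) (real n)) = 1"
proof -
  have "Gamma (real n + 1) = real n * Gamma (real n)"
    using assms by (intro Gamma_plus1) auto
  moreover have "Gamma (real n) \<noteq> 0" "Gamma (real m + 1) \<noteq> 0" "Gamma (real n + real m + 1) \<noteq> 0"
    using assms Gamma_real_pos[of "real n"] Gamma_real_pos[of "real m + 1"]
      Gamma_real_pos[of "real n + real m + 1"] by linarith+
  ultimately show ?thesis
    using assms by (auto simp: real_binomial_def Beta_def add_ac)
qed

lemma nn_integral_Beta_kernel:
  assumes "0 < n"
  shows "(\<integral>\<^sup>+r. ennreal (real n * (1 - r) ^ (n - 1) * r ^ m) * indicator {0<..1} r \<partial>lborel)
    = ennreal (real n * Beta (real m + 1) (real n))"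
proof -
  let ?f = "\<lambda>r::real. real n * (r powr (real m + 1 - 1) * (1 - r) powr (real n - 1))"
  have "(?f has_integral (real n * Beta (real m + 1) (real n))) {0..1}"
    using assms by (intro has_integral_mult_right has_integral_Beta_real) auto
  then have "ennreal (real n * Beta (real m + 1) (real n))
      = (\<integral>\<^sup>+r. indicator {0..1} r * ?f r \<partial>lborel)"
    by (intro nn_integral_has_integral_lebesgue[symmetric]) auto
  also have "\<dots> = (\<integral>\<^sup>+r. ennreal (real n * (1 - r) ^ (n - 1) * r ^ m) * indicator {0<..1} r \<partial>lborel)"
  proof (intro nn_integral_cong_AE)
    \<comment> \<open>For n = 1 the integrands differ at r = 1, since \<open>0 powr 0 = 0\<close>
      but \<open>0 ^ 0 = 1\<close>; discarding the endpoints avoids this.\<close>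
    have "AE r in lborel. r \<noteq> (0::real) \<and> r \<noteq> 1"
      by (intro AE_conjI AE_lborel_singleton)
    then show "AE r in lborel. ennreal (indicator {0..1} r * ?f r) =
        ennreal (real n * (1 - r) ^ (n - 1) * r ^ m) * indicator {0<..1} r"
    proof eventually_elim
      case (elim r)
      have "(1 - r) powr (real n - 1) = (1 - r) ^ (n - 1)" if "r < 1"
        using that assms powr_realpow[of "1 - r" "n - 1"] by (simp add: of_nat_diff)
      then show ?case using elim by (auto simp: indicator_def powr_realpow mult_ac)
    qed
  qed
  finally show ?thesis ..
qed

text \<open>With \<rho> the n-th root of c, the condition on \<open>R\<close> forces it into
  \<open>{1 - \<rho>..1}\<close>. Over that interval the antiderivative -(1 - r)^n increases by
  exactly \<rho>^n = c.\<close>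

lemma nn_integral_power_kernel_le:
  assumes n: "0 < n" and c: "0 \<le> c" "c \<le> 1"
    and R: "\<And>r. r \<in> R \<Longrightarrow> 0 < r \<and> r \<le> 1 \<and> (1 - r) ^ n \<le> c"
  shows "(\<integral>\<^sup>+r. ennreal (real n * (1 - r) ^ (n - 1)) * indicator R r \<partial>lborel) \<le> ennreal c"
proof -
  define \<rho> where "\<rho> = root n c"
  have \<rho>: "0 \<le> \<rho>" "\<rho> \<le> 1" "\<rho> ^ n = c" using n c by (auto simp: \<rho>_def)
  have "R \<subseteq> {1 - \<rho>..1}"
  proof
    fix r assume "r \<in> R"
    then have r: "0 < r" "r \<le> 1" "(1 - r) ^ n \<le> \<rho> ^ n" using R \<rho> by auto
    then have "1 - r \<le> \<rho>" using power_le_imp_le_base[of "1 - r" "n - 1" \<rho>] n \<rho> by simp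
    then show "r \<in> {1 - \<rho>..1}" using r by simp
  qed
  then have "(\<integral>\<^sup>+r. ennreal (real n * (1 - r) ^ (n - 1)) * indicator R r \<partial>lborel)
      \<le> (\<integral>\<^sup>+r. ennreal (real n * (1 - r) ^ (n - 1)) * indicator {1 - \<rho>..1} r \<partial>lborel)"
    by (intro nn_integral_mono mult_left_mono) (auto simp: indicator_def)
  also have "\<dots> = ennreal (- ((1 - 1) ^ n) - (- ((1 - (1 - \<rho>)) ^ n)))"
    using \<rho> n by (intro nn_integral_FTC_Icc) (auto intro!: derivative_eq_intros)
  also have "\<dots> = ennreal c" using \<rho> n by (simp add: zero_power)
  finally show ?thesis .
qed

section \<open>Lebesgue measure in coordinates and affine substitution\<close>

definition lincomb :: "nat \<Rightarrow> (nat \<Rightarrow> nat \<Rightarrow> real) \<Rightarrow> (nat \<Rightarrow> real) \<Rightarrow> nat \<Rightarrow> real"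
  where "lincomb m u t = (\<Sum>i<m. t i *\<^sub>R u i)"

abbreviation Leb :: "nat \<Rightarrow> (nat \<Rightarrow> real) measure"
  where "Leb m \<equiv> Pi\<^sub>M {..<m} (\<lambda>_. lborel)"

interpretation lborel_product: product_sigma_finite "\<lambda>_::nat. lborel :: real measure"
  by standard

lemma sigma_finite_Leb: "sigma_finite_measure (Leb m)"
  by (rule lborel_product.sigma_finite) simp

lemma measurable_lincomb [measurable]: "lincomb m u \<in> Leb m \<rightarrow>\<^sub>M borel"
  using measurable_orthonormal_coordinates by (simp add: lincomb_def[abs_def])

lemma lincomb_restrict: "lincomb m u (restrict t {..<m}) = lincomb m u t"
  by (simp add: lincomb_def)

lemma lincomb_affine:
  "lincomb m u (\<lambda>i. a i + c * t i) = lincomb m u a + c *\<^sub>R lincomb m u t"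
  by (simp add: lincomb_def scaleR_left_distrib sum.distrib scaleR_sum_right)

text \<open>Boxes determine the product measure, and on a box each of the m coordinates contributes
  one factor c by the one-dimensional substitution. The map is restricted to \<open>{..<m}\<close>
  because points of \<open>Leb m\<close> are undefined elsewhere.\<close>

lemma Leb_affine:
  fixes a :: "nat \<Rightarrow> real"
  assumes c: "0 < c"
  shows "Leb m = scale_measure (ennreal (c ^ m))
    (distr (Leb m) (Leb m) (\<lambda>t. \<lambda>i\<in>{..<m}. a i + c * t i))"
    (is "_ = scale_measure _ (distr _ _ ?T)")
proof (rule lborel_product.PiM_eqI[symmetric])
  fix A :: "nat \<Rightarrow> real set"
  assume A: "\<And>i. i \<in> {..<m} \<Longrightarrow> A i \<in> sets lborel"
  have T: "?T \<in> Leb m \<rightarrow>\<^sub>M Leb m" by measurable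
  have 1: "emeasure lborel (A i) = ennreal c * emeasure lborel ((\<lambda>x. a i + c * x) -` A i)"
    if "i < m" for i
  proof -
    have [measurable]: "A i \<in> sets borel" using A that by simp
    have "(\<lambda>x. a i + c * x) -` A i \<in> sets borel"
      using measurable_sets_borel[of "\<lambda>x. a i + c * x" borel "A i"] by simp
    moreover have "(\<integral>\<^sup>+x. indicator (A i) x \<partial>lborel)
        = ennreal c * (\<integral>\<^sup>+x. indicator ((\<lambda>x. a i + c * x) -` A i) x \<partial>lborel)"
      using c nn_integral_real_affine[of "indicator (A i)" c "a i"] by (simp add: indicator_def)
    ultimately show ?thesis by simp
  qed
  have pre: "?T -` Pi\<^sub>E {..<m} A \<inter> space (Leb m) = Pi\<^sub>E {..<m} (\<lambda>i. (\<lambda>x. a i + c * x) -` A i)"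
    by (auto simp: space_PiM PiE_iff extensional_def)
  have "(\<lambda>x. a i + c * x) -` A i \<in> sets lborel" if "i < m" for i
    using measurable_sets_borel[of "\<lambda>x. a i + c * x" borel "A i"] A that by simp
  then have "emeasure (distr (Leb m) (Leb m) ?T) (Pi\<^sub>E {..<m} A)
      = (\<Prod>i<m. emeasure lborel ((\<lambda>x. a i + c * x) -` A i))"
    using A T by (subst emeasure_distr) (auto intro!: sets_PiM_I_finite lborel_product.emeasure_PiM simp: pre)
  then show "emeasure (scale_measure (ennreal (c ^ m)) (distr (Leb m) (Leb m) ?T)) (Pi\<^sub>E {..<m} A)
      = (\<Prod>i\<in>{..<m}. emeasure lborel (A i))"
    using c by (simp add: 1 prod.distrib ennreal_power)
qed auto

text \<open>This serves twice: with scale 1 - r and a translation, to contract K inside R^n, and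
  with scale r and no translation, to dilate inside H.\<close>

lemma nn_integral_Leb_affine:
  assumes g[measurable]: "g \<in> borel_measurable borel" and c: "0 < c"
  shows "(\<integral>\<^sup>+t. g (lincomb m u t) \<partial>Leb m)
    = ennreal (c ^ m) * (\<integral>\<^sup>+t. g (lincomb m u a + c *\<^sub>R lincomb m u t) \<partial>Leb m)"
proof -
  have "(\<integral>\<^sup>+t. g (lincomb m u t) \<partial>Leb m) = ennreal (c ^ m) *
      (\<integral>\<^sup>+t. g (lincomb m u t) \<partial>distr (Leb m) (Leb m) (\<lambda>t. \<lambda>i\<in>{..<m}. a i + c * t i))"
    by (subst Leb_affine[OF c, of m a], subst nn_integral_scale_measure) simp_all
  also have "(\<integral>\<^sup>+t. g (lincomb m u t) \<partial>distr (Leb m) (Leb m) (\<lambda>t. \<lambda>i\<in>{..<m}. a i + c * t i))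
      = (\<integral>\<^sup>+t. g (lincomb m u (\<lambda>i\<in>{..<m}. a i + c * t i)) \<partial>Leb m)"
    by (rule nn_integral_distr) measurable
  finally show ?thesis by (simp add: lincomb_restrict lincomb_affine)
qed

section \<open>Continuity and measurability of the vector operations on sequences\<close>

lemma continuous_on_fun_add:
  fixes f g :: "'a::topological_space \<Rightarrow> 'b \<Rightarrow> real"
  assumes "continuous_on S f" "continuous_on S g"
  shows "continuous_on S (\<lambda>x. f x + g x)"
  using assms by (intro continuous_on_coordinatewise_then_product)
    (auto intro!: continuous_intros dest: continuous_on_product_then_coordinatewise)

lemma continuous_on_fun_diff:
  fixes f g :: "'a::topological_space \<Rightarrow> 'b \<Rightarrow> real"
  assumes "continuous_on S f" "continuous_on S g"
  shows "continuous_on S (\<lambda>x. f x - g x)"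
  using assms by (intro continuous_on_coordinatewise_then_product)
    (auto intro!: continuous_intros dest: continuous_on_product_then_coordinatewise)

lemma continuous_on_fun_scaleR:
  fixes g :: "'a::topological_space \<Rightarrow> 'b \<Rightarrow> real"
  assumes "continuous_on S f" "continuous_on S g"
  shows "continuous_on S (\<lambda>x. f x *\<^sub>R g x)"
  using assms by (intro continuous_on_coordinatewise_then_product)
    (auto intro!: continuous_intros dest: continuous_on_product_then_coordinatewise)

text \<open>With index type \<open>nat\<close> the sequence space is second countable, so a pair of
  Borel maps is again Borel and can be composed with the continuous sum.\<close>

lemma borel_measurable_fun_add [measurable]:
  fixes f g :: "'a \<Rightarrow> nat \<Rightarrow> real"
  assumes "f \<in> borel_measurable M" "g \<in> borel_measurable M"
  shows "(\<lambda>x. f x + g x) \<in> borel_measurable M"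
proof -
  have "(\<lambda>p::(nat \<Rightarrow> real) \<times> (nat \<Rightarrow> real). fst p + snd p) \<in> borel_measurable borel"
    by (intro borel_measurable_continuous_onI continuous_on_fun_add continuous_intros)
  from measurable_compose[OF borel_measurable_Pair[OF assms] this] show ?thesis by simp
qed

lemma borel_measurable_fun_scaleR [measurable]:
  fixes g :: "'a \<Rightarrow> nat \<Rightarrow> real"
  assumes "f \<in> borel_measurable M" "g \<in> borel_measurable M"
  shows "(\<lambda>x. f x *\<^sub>R g x) \<in> borel_measurable M"
proof -
  have "(\<lambda>p::real \<times> (nat \<Rightarrow> real). fst p *\<^sub>R snd p) \<in> borel_measurable borel"
    by (intro borel_measurable_continuous_onI continuous_on_fun_scaleR continuous_intros)
  from measurable_compose[OF borel_measurable_Pair[OF assms] this] show ?thesis by simp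
qed

section \<open>Topology of convex bodies and subspaces\<close>

lemma convex_body_subset: "convex_body n K \<Longrightarrow> K \<subseteq> topspace (Euclidean_space n)"
  by (auto simp: convex_body_def compactin_def)

lemma convex_body_compact: "convex_body n K \<Longrightarrow> compact K"
  by (simp add: convex_body_def Euclidean_space_def compactin_subtopology euclidean_product_topology)

lemma convex_body_convex: "convex_body n K \<Longrightarrow> convex K"
  by (simp add: convex_body_def)

lemma compact_difference_body:
  fixes K :: "(nat \<Rightarrow> real) set"
  assumes "compact K"
  shows "compact {a - b |a b. a \<in> K \<and> b \<in> K}"
proof -
  have "{a - b |a b. a \<in> K \<and> b \<in> K} = (\<lambda>p. fst p - snd p) ` (K \<times> K)" by force
  moreover have "compact \<dots>"
    by (intro compact_continuous_image continuous_on_fun_diff continuous_intros compact_Times assms)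
  ultimately show ?thesis by simp
qed

lemma orthonormal_basis_lincomb_in:
  assumes "orthonormal_basis n H u"
  shows "lincomb (dim H) u t \<in> H"
proof -
  have "lincomb (dim H) u t \<in> span (u ` {..<dim H})"
    unfolding lincomb_def by (intro span_sum span_scale span_base) auto
  then show ?thesis using assms by (simp add: orthonormal_basis_def)
qed

lemma orthonormal_basis_expansion:
  assumes u: "orthonormal_basis n H u" and x: "x \<in> H"
  shows "x = lincomb (dim H) u (\<lambda>i. euclidean_inner n x (u i))"
proof -
  have "x \<in> span (u ` {..<dim H})" using u x by (simp add: orthonormal_basis_def)
  then show ?thesis
  proof (induction rule: span_induct_alt)
    case base
    then show ?case by (simp add: lincomb_def euclidean_inner_def)
  next
    case (step c v y)
    then obtain j where j: "j < dim H" "v = u j" by auto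
    have "euclidean_inner n (c *\<^sub>R v + y) (u i) = euclidean_inner n y (u i) + c * (if i = j then 1 else 0)"
      if "i < dim H" for i
    proof -
      have "euclidean_inner n (c *\<^sub>R v + y) (u i) = c * euclidean_inner n (u j) (u i) + euclidean_inner n y (u i)"
        by (simp add: euclidean_inner_def j algebra_simps sum.distrib sum_distrib_left)
      then show ?thesis using u j that by (auto simp: orthonormal_basis_def)
    qed
    then have "lincomb (dim H) u (\<lambda>i. euclidean_inner n (c *\<^sub>R v + y) (u i))
        = lincomb (dim H) u (\<lambda>i. euclidean_inner n y (u i) + c * (if i = j then 1 else 0))"
      by (simp add: lincomb_def)
    also have "\<dots> = lincomb (dim H) u (\<lambda>i. euclidean_inner n y (u i)) + c *\<^sub>R u j"
      using j by (simp add: lincomb_affine) (simp add: lincomb_def if_distrib[of "\<lambda>x. x *\<^sub>R _"] cong: if_cong)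
    finally show ?case using step(2) j(2) by (metis add.commute)
  qed
qed

text \<open>\<open>H\<close> is the fixed point set of the map sending x to the sum of <x, u i> u i.
  This map is continuous in the product topology because \<open>euclidean_inner n\<close> reads only
  finitely many coordinates.\<close>

lemma orthonormal_basis_closed:
  assumes u: "orthonormal_basis n H u"
  shows "closed H"
proof -
  have "H = {x. x = lincomb (dim H) u (\<lambda>i. euclidean_inner n x (u i))}"
    using orthonormal_basis_expansion[OF u] orthonormal_basis_lincomb_in[OF u]
    by (metis (mono_tags, lifting) Collect_cong mem_Collect_eq Collect_mem_eq)
  also have "closed \<dots>"
    unfolding lincomb_def euclidean_inner_def
    by (intro closed_Collect_eq continuous_on_coordinatewise_then_product)
       (auto simp: sum_fun_apply intro!: continuous_intros)
  finally show ?thesis .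
qed

section \<open>Volume of a convex body\<close>

definition std_basis :: "nat \<Rightarrow> nat \<Rightarrow> real"
  where "std_basis i = (\<lambda>j. if i = j then 1 else 0)"

text \<open>Through \<open>lincomb n std_basis\<close> a point of \<open>Leb n\<close> becomes the
  sequence in R^n with the same first n coordinates, so volume in R^n and measure on H share one
  substitution rule.\<close>

lemma lincomb_std_basis: "lincomb n std_basis t j = (if j < n then t j else 0)"
  by (simp add: lincomb_def std_basis_def sum_fun_apply if_distrib[of "\<lambda>x. _ * x"] cong: if_cong)

lemma lincomb_std_basis_in: "lincomb n std_basis t \<in> topspace (Euclidean_space n)"
  by (simp add: topspace_Euclidean_space lincomb_std_basis)

lemma lincomb_std_basis_self: "x \<in> topspace (Euclidean_space n) \<Longrightarrow> lincomb n std_basis x = x"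
  by (auto simp: topspace_Euclidean_space lincomb_std_basis fun_eq_iff)

lemma compact_volume_finite:
  assumes "compact K"
  shows "(\<integral>\<^sup>+t. indicator K (lincomb n std_basis t) \<partial>Leb n) < \<infinity>"
proof -
  have "\<exists>B. \<forall>x\<in>K. \<bar>x i\<bar> \<le> B" for i
  proof -
    have "bounded ((\<lambda>x. x i) ` K)"
      by (intro compact_imp_bounded compact_continuous_image assms
          continuous_on_subset[OF continuous_on_product_coordinates]) auto
    then show ?thesis by (auto simp: bounded_iff)
  qed
  then obtain B where B: "\<And>i x. x \<in> K \<Longrightarrow> \<bar>x i\<bar> \<le> B i" by metis
  have "(\<integral>\<^sup>+t. indicator K (lincomb n std_basis t) \<partial>Leb n)
      \<le> (\<integral>\<^sup>+t. indicator (Pi\<^sub>E {..<n} (\<lambda>i. {- B i..B i})) t \<partial>Leb n)"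
  proof (rule nn_integral_mono)
    fix t assume t: "t \<in> space (Leb n)"
    have "t \<in> Pi\<^sub>E {..<n} (\<lambda>i. {- B i..B i})" if "lincomb n std_basis t \<in> K"
    proof -
      have "\<bar>t i\<bar> \<le> B i" if "i < n" for i
        using B[OF \<open>lincomb n std_basis t \<in> K\<close>, of i] that by (simp add: lincomb_std_basis)
      then show ?thesis using t by (force simp: space_PiM PiE_iff abs_le_iff)
    qed
    then show "indicator K (lincomb n std_basis t)
        \<le> (indicator (Pi\<^sub>E {..<n} (\<lambda>i. {- B i..B i})) t :: ennreal)"
      by (auto simp: indicator_def)
  qed
  also have "\<dots> = (\<Prod>i<n. emeasure lborel {- B i..B i})"
    by (subst nn_integral_indicator) (auto intro!: sets_PiM_I_finite simp: lborel_product.emeasure_PiM)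
  also have "\<dots> < \<infinity>" by (simp add: less_top[symmetric] ennreal_prod_eq_top emeasure_lborel_Icc_eq)
  finally show ?thesis .
qed

text \<open>An interior point has a neighbourhood in R^n that is the trace of an open product set;
  its first n sides form a box of positive volume inside K.\<close>

lemma convex_body_volume_pos:
  assumes K: "convex_body n K"
  shows "0 < (\<integral>\<^sup>+t. indicator K (lincomb n std_basis t) \<partial>Leb n)"
proof -
  obtain x where x: "x \<in> Euclidean_space n interior_of K" using K by (auto simp: convex_body_def)
  have "openin (subtopology euclidean (topspace (Euclidean_space n))) (Euclidean_space n interior_of K)"
    using openin_interior_of[of "Euclidean_space n" K]
    by (simp add: Euclidean_space_def euclidean_product_topology)
  then obtain V where V: "open V" "Euclidean_space n interior_of K = topspace (Euclidean_space n) \<inter> V"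
    unfolding openin_open by blast
  then have "openin (powertop_real UNIV) V" "x \<in> V" using x by (auto simp: euclidean_product_topology)
  from product_topology_open_contains_basis[OF this]
  obtain X where X: "x \<in> Pi\<^sub>E UNIV X" "\<And>i. openin euclidean (X i)" "Pi\<^sub>E UNIV X \<subseteq> V" by metis
  \<comment> \<open>So 0 lies in \<open>X i\<close> for i \<ge> n, and extending a point of the
    finite box by zeros stays in the infinite product.\<close>
  have x0: "x i = 0" if "i \<ge> n" for i
    using x V that by (auto simp: topspace_Euclidean_space)
  have pos: "emeasure lborel (X i) > 0" for i
  proof -
    obtain e where e: "e > 0" "ball (x i) e \<subseteq> X i"
      using X(1)[THEN PiE_mem, of i] X(2)[of i] open_contains_ball[of "X i"] by force
    have "0 < emeasure lborel (ball (x i) e)" using e by (simp add: ball_eq_greaterThanLessThan)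
    also have "\<dots> \<le> emeasure lborel (X i)"
      using e(2) X(2)[of i] by (intro emeasure_mono) auto
    finally show ?thesis .
  qed
  have "0 < (\<Prod>i<n. emeasure lborel (X i))"
    using pos by (simp add: zero_less_iff_neq_zero)
  also have "\<dots> = (\<integral>\<^sup>+t. indicator (Pi\<^sub>E {..<n} X) t \<partial>Leb n)"
    using X(2) by (subst nn_integral_indicator) (auto intro!: sets_PiM_I_finite simp: lborel_product.emeasure_PiM)
  also have "\<dots> \<le> (\<integral>\<^sup>+t. indicator K (lincomb n std_basis t) \<partial>Leb n)"
  proof (rule nn_integral_mono)
    fix t
    have "lincomb n std_basis t \<in> K" if t: "t \<in> Pi\<^sub>E {..<n} X"
    proof -
      have "lincomb n std_basis t \<in> Pi\<^sub>E UNIV X"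
        using t X(1) x0 by (auto simp: lincomb_std_basis PiE_iff) (metis not_less)
      then have "lincomb n std_basis t \<in> Euclidean_space n interior_of K"
        using V X(3) lincomb_std_basis_in by auto
      then show ?thesis using interior_of_subset[of "Euclidean_space n" K] by blast
    qed
    then show "indicator (Pi\<^sub>E {..<n} X) t
        \<le> (indicator K (lincomb n std_basis t) :: ennreal)"
      by (auto simp: indicator_def)
  qed
  finally show ?thesis .
qed

section \<open>The covariogram of K\<close>

definition covariogram :: "nat \<Rightarrow> (nat \<Rightarrow> real) set \<Rightarrow> (nat \<Rightarrow> real) \<Rightarrow> ennreal"
  where "covariogram n K x =
    (\<integral>\<^sup>+t. indicator K (lincomb n std_basis t) * indicator K (lincomb n std_basis t + x) \<partial>Leb n)"

lemma measurable_covariogram [measurable]: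
  assumes [measurable]: "K \<in> sets borel"
  shows "covariogram n K \<in> borel_measurable borel"
proof -
  interpret sigma_finite_measure "Leb n" by (rule sigma_finite_Leb)
  show ?thesis unfolding covariogram_def[abs_def] by measurable
qed

lemma covariogram_le:
  "covariogram n K x \<le> (\<integral>\<^sup>+t. indicator K (lincomb n std_basis t) \<partial>Leb n)"
  unfolding covariogram_def by (intro nn_integral_mono) (auto simp: indicator_def)

text \<open>For \<open>a, b \<in> K\<close>, the shrunken copy \<open>r b + (1 - r) K\<close> lies in \<open>K\<close>, and so does its
  translate by \<open>r (a - b)\<close>.\<close>

lemma covariogram_scaled_difference_ge:
  assumes K: "convex_body n K" and ab: "a \<in> K" "b \<in> K" and r: "0 \<le> r" "r \<le> 1" and n: "0 < n"
  shows "ennreal ((1 - r) ^ n) * (\<integral>\<^sup>+t. indicator K (lincomb n std_basis t) \<partial>Leb n)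
    \<le> covariogram n K (r *\<^sub>R (a - b))"
\<comment> \<open>The substitution requires 1 - r > 0; at r = 1 the left side vanishes because n >
  0.\<close>
proof (cases "r = 1")
  case True
  then show ?thesis using n by (simp add: zero_power)
next
  case False
  let ?L = "lincomb n std_basis"
  have [measurable]: "K \<in> sets borel"
    using convex_body_compact[OF K] by (simp add: compact_imp_closed)
  have Lb: "?L (\<lambda>i. r * b i) = r *\<^sub>R b"
    using ab convex_body_subset[OF K] by (subst lincomb_std_basis_self) (auto simp: topspace_Euclidean_space scaleR_fun_def)
  have "indicator K (?L t) \<le> (indicator K (r *\<^sub>R b + (1 - r) *\<^sub>R ?L t) *
      indicator K (r *\<^sub>R b + (1 - r) *\<^sub>R ?L t + r *\<^sub>R (a - b)) :: ennreal)" for t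
  proof (cases "?L t \<in> K")
    case True
    have "r *\<^sub>R b + (1 - r) *\<^sub>R ?L t \<in> K" "r *\<^sub>R a + (1 - r) *\<^sub>R ?L t \<in> K"
      using convex_body_convex[OF K] ab True r by (auto intro!: convexD)
    moreover have "r *\<^sub>R b + (1 - r) *\<^sub>R ?L t + r *\<^sub>R (a - b) = r *\<^sub>R a + (1 - r) *\<^sub>R ?L t"
      by (auto simp: fun_eq_iff algebra_simps)
    ultimately show ?thesis using True by (simp only: indicator_simps) simp
  qed simp
  then have "(\<integral>\<^sup>+t. indicator K (?L t) \<partial>Leb n) \<le> (\<integral>\<^sup>+t. indicator K (r *\<^sub>R b + (1 - r) *\<^sub>R ?L t) *
      indicator K (r *\<^sub>R b + (1 - r) *\<^sub>R ?L t + r *\<^sub>R (a - b)) \<partial>Leb n)"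
    by (rule nn_integral_mono)
  then have "ennreal ((1 - r) ^ n) * (\<integral>\<^sup>+t. indicator K (?L t) \<partial>Leb n)
      \<le> ennreal ((1 - r) ^ n) * (\<integral>\<^sup>+t. indicator K (r *\<^sub>R b + (1 - r) *\<^sub>R ?L t) *
      indicator K (r *\<^sub>R b + (1 - r) *\<^sub>R ?L t + r *\<^sub>R (a - b)) \<partial>Leb n)"
    by (rule mult_left_mono) simp
  also have "\<dots> = covariogram n K (r *\<^sub>R (a - b))"
    unfolding covariogram_def
    using nn_integral_Leb_affine[of "\<lambda>y. indicator K y * indicator K (y + r *\<^sub>R (a - b)) :: ennreal"
        "1 - r" n std_basis "\<lambda>i. r * b i"] False r
    by (simp add: Lb)
  finally show ?thesis .
qed

text \<open>The layer-cake form of \<open>covariogram n K x \<ge> (1 - \<parallel>x\<parallel>)^n vol K\<close>, where \<open>\<parallel>\<cdot>\<parallel>\<close> is the gauge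
  of \<open>K - K\<close>.\<close>

lemma covariogram_ge_layer_cake:
  assumes K: "convex_body n K" and n: "0 < n"
  shows "(\<integral>\<^sup>+t. indicator K (lincomb n std_basis t) \<partial>Leb n) *
      (\<integral>\<^sup>+r. ennreal (real n * (1 - r) ^ (n - 1)) *
        (indicator {0<..1} r * indicator {a - b |a b. a \<in> K \<and> b \<in> K} ((1 / r) *\<^sub>R x)) \<partial>lborel)
    \<le> covariogram n K x"
proof -
  let ?D = "{a - b |a b. a \<in> K \<and> b \<in> K}"
  define R where "R = {r::real. 0 < r \<and> r \<le> 1 \<and> (1 / r) *\<^sub>R x \<in> ?D}"
  \<comment> \<open>Volume and covariogram are finite and the volume is positive, so v / q is a real
    number in [0, 1] and can serve as the bound c of
    \<open>nn_integral_power_kernel_le\<close>.\<close>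
  obtain q where q: "(\<integral>\<^sup>+t. indicator K (lincomb n std_basis t) \<partial>Leb n) = ennreal q" "0 < q"
    using compact_volume_finite[OF convex_body_compact[OF K], of n] convex_body_volume_pos[OF K]
    by (cases "\<integral>\<^sup>+t. indicator K (lincomb n std_basis t) \<partial>Leb n") auto
  obtain v where v: "covariogram n K x = ennreal v" "0 \<le> v" "v \<le> q"
    using covariogram_le[of n K x] q by (cases "covariogram n K x") (auto simp: top_unique)
  have "(1 - r) ^ n \<le> v / q" if "r \<in> R" for r
  proof -
    have r: "0 < r" "r \<le> 1" and "\<exists>a b. (1 / r) *\<^sub>R x = a - b \<and> a \<in> K \<and> b \<in> K"
      using that by (simp_all only: R_def mem_Collect_eq)
    then obtain a b where ab: "a \<in> K" "b \<in> K" "(1 / r) *\<^sub>R x = a - b" by metis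
    have "x = r *\<^sub>R ((1 / r) *\<^sub>R x)" using r by simp
    then have "x = r *\<^sub>R (a - b)" using ab by metis
    then have "ennreal ((1 - r) ^ n) * ennreal q \<le> ennreal v"
      using covariogram_scaled_difference_ge[OF K ab(1,2) _ r(2) n] r q v by simp
    then have "(1 - r) ^ n * q \<le> v" using q v r by (simp flip: ennreal_mult)
    then show ?thesis using q by (simp add: field_simps)
  qed
  then have "(\<integral>\<^sup>+r. ennreal (real n * (1 - r) ^ (n - 1)) * indicator R r \<partial>lborel) \<le> ennreal (v / q)"
    using n v q by (intro nn_integral_power_kernel_le) (auto simp: R_def)
  then have "ennreal q * (\<integral>\<^sup>+r. ennreal (real n * (1 - r) ^ (n - 1)) * indicator R r \<partial>lborel)
      \<le> ennreal q * ennreal (v / q)"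
    by (rule mult_left_mono) simp
  also have "\<dots> = covariogram n K x" using v q by (simp flip: ennreal_mult)
  also have "(indicator R :: real \<Rightarrow> ennreal) = (\<lambda>r. indicator {0<..1} r * indicator ?D ((1 / r) *\<^sub>R x))"
    by (auto simp: R_def indicator_def fun_eq_iff)
  finally show ?thesis by (simp only: q)
qed

section \<open>Section measures and the inequality for s = 0\<close>

text \<open>The weight \<open>w\<close> is the density extended by zero from the closed set R^n,
  hence Borel on all sequences. The intersection with H disappears from the integrand because the
  coordinate map already lands in H.\<close>

lemma section_measure_lincomb:
  assumes \<phi>: "\<phi> \<in> borel_measurable (restrict_space borel (topspace (Euclidean_space n)))"
    and H: "subspace H" "H \<subseteq> topspace (Euclidean_space n)"
  obtains w u where "w \<in> borel_measurable borel"
    "\<And>x. x \<in> topspace (Euclidean_space n) \<Longrightarrow> w x = ennreal (\<phi> x)"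
    "\<And>t. lincomb (dim H) u t \<in> H"
    "\<And>A. A \<in> sets borel \<Longrightarrow> section_measure n \<phi> H A =
      (\<integral>\<^sup>+t. w (lincomb (dim H) u t) * indicator A (lincomb (dim H) u t) \<partial>Leb (dim H))"
proof -
  let ?E = "topspace (Euclidean_space n)"
  define u where "u = (SOME u. orthonormal_basis n H u)"
  have u: "orthonormal_basis n H u"
    unfolding u_def using ex_orthonormal_basis[OF H] by (rule someI_ex)
  define w where "w x = ennreal (indicator ?E x *\<^sub>R \<phi> x)" for x
  have "closed ?E" by (rule closedin_Euclidean_imp_closed[OF closedin_topspace])
  then have w: "w \<in> borel_measurable borel"
    using \<phi> by (simp add: w_def[abs_def] borel_measurable_restrict_space_iff)
  have wE: "w x = ennreal (\<phi> x)" if "x \<in> ?E" for x using that by (simp add: w_def)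
  have LH: "lincomb (dim H) u t \<in> H" for t by (rule orthonormal_basis_lincomb_in[OF u])
  have "section_measure n \<phi> H A =
      (\<integral>\<^sup>+t. w (lincomb (dim H) u t) * indicator A (lincomb (dim H) u t) \<partial>Leb (dim H))"
    if [measurable]: "A \<in> sets borel" for A
  proof -
    have [measurable]: "H \<in> sets borel" using orthonormal_basis_closed[OF u] by simp
    note w[measurable]
    have "section_measure n \<phi> H A = (\<integral>\<^sup>+x. w x * indicator (A \<inter> H) x \<partial>subspace_lborel n H)"
      unfolding section_measure_def using H(2) by (intro nn_integral_cong) (auto simp: wE indicator_def)
    also have "subspace_lborel n H = distr (Leb (dim H)) borel (lincomb (dim H) u)"
      by (simp add: subspace_lborel_def Let_def u_def lincomb_def[abs_def])
    also have "(\<integral>\<^sup>+x. w x * indicator (A \<inter> H) x \<partial>distr (Leb (dim H)) borel (lincomb (dim H) u))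
        = (\<integral>\<^sup>+t. w (lincomb (dim H) u t) * indicator (A \<inter> H) (lincomb (dim H) u t) \<partial>Leb (dim H))"
      by (rule nn_integral_distr) measurable
    also have "\<dots> = (\<integral>\<^sup>+t. w (lincomb (dim H) u t) * indicator A (lincomb (dim H) u t) \<partial>Leb (dim H))"
      using LH by (intro nn_integral_cong) (auto simp: indicator_def)
    finally show ?thesis .
  qed
  with w wE LH show thesis by (rule that)
qed

lemma section_measure_difference_body_le:
  assumes n: "0 < n"
    and \<phi>: "\<phi> \<in> borel_measurable (restrict_space borel (topspace (Euclidean_space n)))"
    and rad: "radially_decreasing n \<phi>"
    and H: "subspace H" "H \<subseteq> topspace (Euclidean_space n)"
    and K: "convex_body n K"
  shows "section_measure n \<phi> H {a - b |a b. a \<in> K \<and> b \<in> K}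
    \<le> ennreal (real_binomial (real n + real (dim H)) (real (dim H))) *
      (SUP y\<in>topspace (Euclidean_space n). section_measure n \<phi> H ((\<lambda>x. x - y) ` K))"
proof -
  define m where "m = dim H"
  let ?E = "topspace (Euclidean_space n)" and ?D = "{a - b |a b. a \<in> K \<and> b \<in> K}"
  let ?S = "SUP y\<in>?E. section_measure n \<phi> H ((\<lambda>x. x - y) ` K)"
  let ?N = "lincomb n std_basis"
  define vol where "vol = (\<integral>\<^sup>+t. indicator K (?N t) \<partial>Leb n)"
  \<comment> \<open>This is the layer-cake density: its integral over r \<ge> g is (1 - g)^n for 0
    \<le> g \<le> 1.\<close>
  define \<kappa> :: "real \<Rightarrow> ennreal" where "\<kappa> r = ennreal (real n * (1 - r) ^ (n - 1)) * indicator {0<..1} r" for r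
  obtain w u where w[measurable]: "w \<in> borel_measurable borel"
    and wE: "\<And>x. x \<in> ?E \<Longrightarrow> w x = ennreal (\<phi> x)"
    and LH': "\<And>t. lincomb (dim H) u t \<in> H"
    and sec': "\<And>A. A \<in> sets borel \<Longrightarrow> section_measure n \<phi> H A =
      (\<integral>\<^sup>+t. w (lincomb (dim H) u t) * indicator A (lincomb (dim H) u t) \<partial>Leb (dim H))"
    using section_measure_lincomb[OF \<phi> H] by blast
  let ?L = "lincomb m u"
  note LH = LH'[folded m_def] and sec = sec'[folded m_def]
  have K_borel[measurable]: "K \<in> sets borel"
    using convex_body_compact[OF K] by (simp add: compact_imp_closed)
  have D_borel[measurable]: "?D \<in> sets borel"
    using compact_difference_body[OF convex_body_compact[OF K]] by (simp add: compact_imp_closed)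
  have \<kappa>_borel[measurable]: "\<kappa> \<in> borel_measurable borel" unfolding \<kappa>_def[abs_def] by measurable
  interpret Leb_m: sigma_finite_measure "Leb m" by (rule sigma_finite_Leb)
  interpret Leb_n: sigma_finite_measure "Leb n" by (rule sigma_finite_Leb)
  interpret Leb_mn: pair_sigma_finite "Leb m" "Leb n" ..
  interpret Leb_mr: pair_sigma_finite "Leb m" "lborel :: real measure" ..

  have translate: "section_measure n \<phi> H ((\<lambda>x. x - y) ` K) = (\<integral>\<^sup>+t. w (?L t) * indicator K (y + ?L t) \<partial>Leb m)"
    for y
  proof -
    have eq: "(\<lambda>x. x - y) ` K = {x. y + x \<in> K}"
      by (auto simp: image_iff) (metis add_diff_cancel_left')
    have "(\<lambda>x. y + x) -` K \<inter> space borel \<in> sets borel"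
      by (rule measurable_sets[OF _ K_borel]) measurable
    then have "{x. y + x \<in> K} \<in> sets borel" by (simp add: vimage_def)
    then show ?thesis
      unfolding eq by (subst sec) (auto intro!: nn_integral_cong simp: indicator_def)
  qed

  \<comment> \<open>After swapping the integrals, the inner one is the section measure of K
    translated by -\<open>?N s\<close>, hence at most \<open>?S\<close>; the outer one then
    contributes \<open>vol\<close>.\<close>
  have "(\<integral>\<^sup>+t. w (?L t) * covariogram n K (?L t) \<partial>Leb m)
      = (\<integral>\<^sup>+t. \<integral>\<^sup>+s. w (?L t) * (indicator K (?N s) * indicator K (?N s + ?L t)) \<partial>Leb n \<partial>Leb m)"
    unfolding covariogram_def by (intro nn_integral_cong nn_integral_cmult[symmetric]) measurable
  also have "\<dots> = (\<integral>\<^sup>+s. \<integral>\<^sup>+t. w (?L t) * (indicator K (?N s) * indicator K (?N s + ?L t)) \<partial>Leb m \<partial>Leb n)"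
    by (intro Leb_mn.Fubini'[symmetric]) measurable
  also have "\<dots> = (\<integral>\<^sup>+s. indicator K (?N s) * (\<integral>\<^sup>+t. w (?L t) * indicator K (?N s + ?L t) \<partial>Leb m) \<partial>Leb n)"
    by (intro nn_integral_cong) (subst nn_integral_cmult[symmetric], measurable, simp add: ac_simps)
  also have "\<dots> \<le> (\<integral>\<^sup>+s. indicator K (?N s) * ?S \<partial>Leb n)"
    unfolding translate[symmetric]
    by (intro nn_integral_mono mult_left_mono SUP_upper lincomb_std_basis_in) simp
  also have "\<dots> = vol * ?S"
    unfolding vol_def by (rule nn_integral_multc) measurable
  finally have upper: "(\<integral>\<^sup>+t. w (?L t) * covariogram n K (?L t) \<partial>Leb m) \<le> vol * ?S" .

  \<comment> \<open>The density at r x is at least the density at x; substituting x / r for x then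
    absorbs the factor r^m and turns the region D into r D.\<close>
  have shrink: "ennreal (r ^ m) * section_measure n \<phi> H ?D
      \<le> (\<integral>\<^sup>+t. w (?L t) * indicator ?D ((1 / r) *\<^sub>R ?L t) \<partial>Leb m)"
    if r: "0 < r" "r \<le> 1" for r
  proof -
    have "section_measure n \<phi> H ?D \<le> (\<integral>\<^sup>+t. w (r *\<^sub>R ?L t) * indicator ?D (?L t) \<partial>Leb m)"
      unfolding sec[OF D_borel]
    proof (intro nn_integral_mono mult_right_mono)
      fix t
      have "?L t \<in> ?E" "r *\<^sub>R ?L t \<in> ?E" using LH H subspace_scale[OF H(1)] by blast+
      then show "w (?L t) \<le> w (r *\<^sub>R ?L t)"
        using rad r by (auto simp: wE radially_decreasing_def intro!: ennreal_leI)
    qed simp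
    then have "ennreal (r ^ m) * section_measure n \<phi> H ?D
        \<le> ennreal (r ^ m) * (\<integral>\<^sup>+t. w (r *\<^sub>R ?L t) * indicator ?D (?L t) \<partial>Leb m)"
      by (rule mult_left_mono) simp
    also have "\<dots> = (\<integral>\<^sup>+t. w (?L t) * indicator ?D ((1 / r) *\<^sub>R ?L t) \<partial>Leb m)"
      using nn_integral_Leb_affine[of "\<lambda>x. w x * indicator ?D ((1 / r) *\<^sub>R x)" r m u "\<lambda>_. 0"] r
      by (simp add: lincomb_def[of m u "\<lambda>_. 0"])
    finally show ?thesis .
  qed

  \<comment> \<open>The integral of \<open>\<kappa> r * r ^ m\<close>, and the reciprocal of the
    binomial coefficient for s = 0.\<close>
  define \<beta> where "\<beta> = real n * Beta (real m + 1) (real n)"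
  have "section_measure n \<phi> H ?D * ennreal \<beta> = (\<integral>\<^sup>+r. \<kappa> r * (ennreal (r ^ m) * section_measure n \<phi> H ?D) \<partial>lborel)"
  proof -
    have "ennreal \<beta> = (\<integral>\<^sup>+r. \<kappa> r * ennreal (r ^ m) \<partial>lborel)"
      unfolding \<beta>_def nn_integral_Beta_kernel[OF n, symmetric]
      by (intro nn_integral_cong) (auto simp: \<kappa>_def indicator_def simp flip: ennreal_mult)
    then show ?thesis
      by (simp add: nn_integral_multc mult.commute flip: mult.assoc)
  qed
  also have "\<dots> \<le> (\<integral>\<^sup>+r. \<kappa> r * (\<integral>\<^sup>+t. w (?L t) * indicator ?D ((1 / r) *\<^sub>R ?L t) \<partial>Leb m) \<partial>lborel)"
    using shrink by (intro nn_integral_mono) (auto simp: \<kappa>_def indicator_def intro!: mult_left_mono)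
  also have "\<dots> = (\<integral>\<^sup>+r. \<integral>\<^sup>+t. w (?L t) * (\<kappa> r * indicator ?D ((1 / r) *\<^sub>R ?L t)) \<partial>Leb m \<partial>lborel)"
    by (intro nn_integral_cong) (subst nn_integral_cmult[symmetric], measurable, simp add: ac_simps)
  also have "\<dots> = (\<integral>\<^sup>+t. \<integral>\<^sup>+r. w (?L t) * (\<kappa> r * indicator ?D ((1 / r) *\<^sub>R ?L t)) \<partial>lborel \<partial>Leb m)"
    by (intro Leb_mr.Fubini') measurable
  also have "\<dots> = (\<integral>\<^sup>+t. w (?L t) * (\<integral>\<^sup>+r. \<kappa> r * indicator ?D ((1 / r) *\<^sub>R ?L t) \<partial>lborel) \<partial>Leb m)"
    by (intro nn_integral_cong nn_integral_cmult) measurable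
  finally have lower: "section_measure n \<phi> H ?D * ennreal \<beta>
      \<le> (\<integral>\<^sup>+t. w (?L t) * (\<integral>\<^sup>+r. \<kappa> r * indicator ?D ((1 / r) *\<^sub>R ?L t) \<partial>lborel) \<partial>Leb m)" .

  \<comment> \<open>The factor \<open>vol\<close> lets \<open>covariogram_ge_layer_cake\<close>
    replace the inner integral by the covariogram, where the bounds \<open>lower\<close> and
    \<open>upper\<close> meet.\<close>
  have "vol * (section_measure n \<phi> H ?D * ennreal \<beta>)
      \<le> vol * (\<integral>\<^sup>+t. w (?L t) * (\<integral>\<^sup>+r. \<kappa> r * indicator ?D ((1 / r) *\<^sub>R ?L t) \<partial>lborel) \<partial>Leb m)"
    using lower by (rule mult_left_mono) simp
  also have "\<dots> = (\<integral>\<^sup>+t. w (?L t) * (vol * (\<integral>\<^sup>+r. \<kappa> r * indicator ?D ((1 / r) *\<^sub>R ?L t) \<partial>lborel)) \<partial>Leb m)"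
    by (subst nn_integral_cmult[symmetric], measurable, simp add: ac_simps)
  also have "\<dots> \<le> (\<integral>\<^sup>+t. w (?L t) * covariogram n K (?L t) \<partial>Leb m)"
    using covariogram_ge_layer_cake[OF K n]
    by (intro nn_integral_mono mult_left_mono) (simp_all add: vol_def \<kappa>_def mult.assoc)
  also note upper
  finally have "vol * (section_measure n \<phi> H ?D * ennreal \<beta>) \<le> vol * ?S" .
  \<comment> \<open>Cancelling \<open>vol\<close> in the extended reals requires that it be neither
    0 nor infinite.\<close>
  moreover have "0 < vol" "vol < top"
    unfolding vol_def using convex_body_volume_pos[OF K] compact_volume_finite[OF convex_body_compact[OF K], of n]
    by auto
  ultimately have main: "section_measure n \<phi> H ?D * ennreal \<beta> \<le> ?S"
    by (simp add: ennreal_mult_le_mult_iff)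
  let ?B = "real_binomial (real n + real m) (real m)"
  have B: "0 < ?B" "?B * \<beta> = 1" 
    using real_binomial_pos[of "real m" n] real_binomial_eq_inverse_Beta[OF n, of m]
    by (simp_all add: \<beta>_def)
  then have "0 < \<beta>" by (metis zero_less_mult_pos zero_less_one)
  then have "section_measure n \<phi> H ?D = ennreal ?B * (section_measure n \<phi> H ?D * ennreal \<beta>)"
    using B by (simp add: mult.left_commute[of "ennreal ?B"] flip: ennreal_mult)
  also have "\<dots> \<le> ennreal ?B * ?S" using main by (rule mult_left_mono) simp
  finally show ?thesis by (simp add: m_def)
qed

theorem corollary2:
  shows "\<exists>C::real. C > 0 \<and>
    (\<forall>(n::nat) (m::nat) (\<phi> :: (nat \<Rightarrow> real) \<Rightarrow> real) (H :: (nat \<Rightarrow> real) set)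
        (K :: (nat \<Rightarrow> real) set) (s::real).
      1 \<le> m \<longrightarrow> m \<le> n \<longrightarrow>
      \<phi> \<in> borel_measurable (restrict_space borel (topspace (Euclidean_space n))) \<longrightarrow>
      (\<forall>x\<in>topspace (Euclidean_space n). 0 \<le> \<phi> x) \<longrightarrow>
      radially_decreasing n \<phi> \<longrightarrow>
      subspace H \<longrightarrow> H \<subseteq> topspace (Euclidean_space n) \<longrightarrow> dim H = m \<longrightarrow>
      convex_body n K \<longrightarrow> 0 < s \<longrightarrow>
      (let S = (SUP y\<in>topspace (Euclidean_space n). section_measure n \<phi> H ((\<lambda>x. x - y) ` K))
       in section_measure n \<phi> H {a - b |a b. a \<in> K \<and> b \<in> K}
            \<le> ennreal (real_binomial (real n + real m + s) (real m + s)) * S \<and>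
          ennreal (real_binomial (real n + real m + s) (real m + s)) * S
            \<le> ennreal ((C * ((real n + s) / (real m + s))) powr (real m + s)) * S))"
\<comment> \<open>The factor e comes from \<open>real_binomial_le_powr\<close>, the factor 2 from n
  + m + s \<le> 2 (n + s), which holds because m \<le> n.\<close>
proof (rule exI[of _ "2 * exp 1"], intro conjI allI impI)
  show "0 < (2 * exp 1 :: real)" by simp
next
  fix n m :: nat and \<phi> :: "(nat \<Rightarrow> real) \<Rightarrow> real" and H K :: "(nat \<Rightarrow> real) set" and s :: real
  assume m: "1 \<le> m" "m \<le> n"
    and \<phi>: "\<phi> \<in> borel_measurable (restrict_space borel (topspace (Euclidean_space n)))"
    and rad: "radially_decreasing n \<phi>"
    and H: "subspace H" "H \<subseteq> topspace (Euclidean_space n)" "dim H = m"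
    and K: "convex_body n K" and s: "0 < s"
  define S where "S = (SUP y\<in>topspace (Euclidean_space n). section_measure n \<phi> H ((\<lambda>x. x - y) ` K))"
  let ?B = "real_binomial (real n + (real m + s)) (real m + s)"
  have "section_measure n \<phi> H {a - b |a b. a \<in> K \<and> b \<in> K}
      \<le> ennreal (real_binomial (real n + real m) (real m)) * S"
    using section_measure_difference_body_le[OF _ \<phi> rad H(1,2) K] m H(3) by (simp add: S_def)
  \<comment> \<open>The geometric inequality does not involve s; it enters here by raising the
    binomial parameter from m to m + s.\<close>
  also have "\<dots> \<le> ennreal ?B * S"
    using s by (intro mult_right_mono ennreal_leI real_binomial_mono) auto
  finally have 1: "section_measure n \<phi> H {a - b |a b. a \<in> K \<and> b \<in> K} \<le> ennreal ?B * S" .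
  have "?B \<le> (exp 1 * ((real n + (real m + s)) / (real m + s))) powr (real m + s)"
    using m s by (intro real_binomial_le_powr) auto
  also have "\<dots> \<le> (2 * exp 1 * ((real n + s) / (real m + s))) powr (real m + s)"
  proof (rule powr_mono2)
    have "(real n + (real m + s)) / (real m + s) \<le> (2 * (real n + s)) / (real m + s)"
      using m s by (intro divide_right_mono) auto
    then show "exp 1 * ((real n + (real m + s)) / (real m + s)) \<le> 2 * exp 1 * ((real n + s) / (real m + s))"
      by (metis (no_types) exp_ge_zero mult.assoc mult.left_commute mult_left_mono times_divide_eq_right)
  qed (use s in auto)
  finally have 2: "ennreal ?B * S
      \<le> ennreal ((2 * exp 1 * ((real n + s) / (real m + s))) powr (real m + s)) * S"
    by (intro mult_right_mono ennreal_leI) auto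
  show "let S = (SUP y\<in>topspace (Euclidean_space n). section_measure n \<phi> H ((\<lambda>x. x - y) ` K))
       in section_measure n \<phi> H {a - b |a b. a \<in> K \<and> b \<in> K}
            \<le> ennreal (real_binomial (real n + real m + s) (real m + s)) * S \<and>
          ennreal (real_binomial (real n + real m + s) (real m + s)) * S
            \<le> ennreal ((2 * exp 1 * ((real n + s) / (real m + s))) powr (real m + s)) * S"
    using 1 2 by (simp add: Let_def S_def add.assoc)
qed

end
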